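(* Let $(X_0,Y_0)\in PPS$ be strongly efficient, with $X_0=(x_{10},\dots,x_{m0})^T$ and $Y_0=(y_{10},\dots,y_{s0})^T$ having strictly positive components. Let $\omega_i\ge 0$ ($i=1,\dots,m$) with $\sum_{i=1}^m\omega_i=m$ and $\delta_r\ge 0$ ($r=1,\dots,s$) with $\sum_{r=1}^s\delta_r=s$ be fixed, and suppose that $(X_0,Y_0)$ is not of the directional smallest scale size in the direction $(\omega_i)$, $(\delta_r)$. For $t>0$ let $\psi^*(t)$ be the optimal value of $$\min_{\beta,\lambda_j}\ \beta/t\quad\text{s.t.}\quad \sum_{j=1}^n\lambda_jx_{ij}\le(1-\omega_it)x_{i0}\ (i=1,\dots,m),\quad \sum_{j=1}^n\lambda_jy_{rj}\ge(1-\delta_r\beta)y_{r0}\ (r=1,\dots,s),\quad \sum_{j=1}^n\lambda_j=1,\ \lambda_j\ge0,\ \beta\in\mathbb{R}.$$ Then there exist $t_0^->0$ and a real number $c$ such that $\psi^*(t)=c$ for all $t\in(0,t_0^-]$.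
   Context: Data: input vectors $X_j=(x_{1j},\dots,x_{mj})^T\in\mathbb{R}^m$ and output vectors $Y_j=(y_{1j},\dots,y_{sj})^T\in\mathbb{R}^s$ with nonnegative components, $j=1,\dots,n$. The production possibility set (variable returns to scale) is $$PPS=\Big\{(X,Y)\in\mathbb{R}^m\times\mathbb{R}^s:\ X\ge\sum_{j=1}^n\lambda_jX_j,\ Y\le\sum_{j=1}^n\lambda_jY_j,\ \sum_{j=1}^n\lambda_j=1,\ \lambda_j\ge0\Big\},$$ with componentwise inequalities. A point $(X,Y)\in PPS$ is strongly efficient if there is no $(\bar X,\bar Y)\in PPS$ with $(-\bar X,\bar Y)\ge(-X,Y)$ and $(\bar X,\bar Y)\ne(X,Y)$. For $t,\beta\in\mathbb{R}$ put $\Omega_t=\mathrm{diag}\{1+\omega_1t,\dots,1+\omega_mt\}$ and $\Phi_\beta=\mathrm{diag}\{1+\delta_1\beta,\dots,1+\delta_s\beta\}$. A strongly efficient $(X_0,Y_0)$ is of the directional smallest scale size (in the direction $(\omega_i)$, $(\delta_r)$) if $(\Omega_tX_0,\Phi_\beta Y_0)\notin PPS$ for every $\beta\in\mathbb{R}$ and every $t<0$. *)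

theory Defs
  imports "HOL-Analysis.Analysis"
begin

(* The order on real^'k, and on pairs of such vectors, is the componentwise one. *)

definition PPS :: "('n::finite \<Rightarrow> real^'m) \<Rightarrow> ('n \<Rightarrow> real^'s) \<Rightarrow> ((real^'m) \<times> (real^'s)) set" where
  "PPS X Y = {(U, V). \<exists>l :: 'n \<Rightarrow> real.
      (\<Sum>j\<in>UNIV. l j *\<^sub>R X j) \<le> U \<and> V \<le> (\<Sum>j\<in>UNIV. l j *\<^sub>R Y j) \<and>
      (\<Sum>j\<in>UNIV. l j) = 1 \<and> (\<forall>j. 0 \<le> l j)}"

definition strongly_efficient ::
  "('n::finite \<Rightarrow> real^'m) \<Rightarrow> ('n \<Rightarrow> real^'s) \<Rightarrow> real^'m \<Rightarrow> real^'s \<Rightarrow> bool" where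
  "strongly_efficient X Y U V \<longleftrightarrow> (U, V) \<in> PPS X Y \<and>
     \<not> (\<exists>U' V'. (U', V') \<in> PPS X Y \<and> (- U, V) \<le> (- U', V') \<and> (U', V') \<noteq> (U, V))"

(* diag {1 + w_1 t, ..., 1 + w_k t}; serves both for Omega_t and for Phi_beta *)
definition scaling_matrix :: "real^'k \<Rightarrow> real \<Rightarrow> real^'k^'k" where
  "scaling_matrix w t = (\<chi> i j. if i = j then 1 + w $ i * t else 0)"

definition directional_smallest_scale_size ::
  "('n::finite \<Rightarrow> real^'m) \<Rightarrow> ('n \<Rightarrow> real^'s) \<Rightarrow> real^'m \<Rightarrow> real^'s \<Rightarrow> real^'m \<Rightarrow> real^'s \<Rightarrow> bool" where
  "directional_smallest_scale_size X Y \<omega> \<delta> U V \<longleftrightarrow> strongly_efficient X Y U V \<and>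
     (\<forall>\<beta> t. t < 0 \<longrightarrow> (scaling_matrix \<omega> t *v U, scaling_matrix \<delta> \<beta> *v V) \<notin> PPS X Y)"

definition psi_feasible ::
  "('n::finite \<Rightarrow> real^'m) \<Rightarrow> ('n \<Rightarrow> real^'s) \<Rightarrow> real^'m \<Rightarrow> real^'s \<Rightarrow> real^'m \<Rightarrow> real^'s \<Rightarrow>
     real \<Rightarrow> real \<times> ('n \<Rightarrow> real) \<Rightarrow> bool" where
  "psi_feasible X Y \<omega> \<delta> X0 Y0 t = (\<lambda>(\<beta>, l).
     (\<forall>i. (\<Sum>j\<in>UNIV. l j * X j $ i) \<le> (1 - \<omega> $ i * t) * X0 $ i) \<and>
     (\<forall>r. (1 - \<delta> $ r * \<beta>) * Y0 $ r \<le> (\<Sum>j\<in>UNIV. l j * Y j $ r)) \<and>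
     (\<Sum>j\<in>UNIV. l j) = 1 \<and> (\<forall>j. 0 \<le> l j))"

(* "psi*(t) = v": the minimum of beta / t exists, is attained, and equals v.  Stated as a
   relation so that infeasibility or unboundedness is not hidden by a default value. *)
definition psi_optimal_value ::
  "('n::finite \<Rightarrow> real^'m) \<Rightarrow> ('n \<Rightarrow> real^'s) \<Rightarrow> real^'m \<Rightarrow> real^'s \<Rightarrow> real^'m \<Rightarrow> real^'s \<Rightarrow>
     real \<Rightarrow> real \<Rightarrow> bool" where
  "psi_optimal_value X Y \<omega> \<delta> X0 Y0 t v \<longleftrightarrow>
     (\<exists>\<beta> l. is_arg_min (\<lambda>(\<beta>, l). \<beta> / t) (psi_feasible X Y \<omega> \<delta> X0 Y0 t) (\<beta>, l) \<and> v = \<beta> / t)"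

end

theory Submission
  imports Defs
begin

text \<open>
  Without the division by \<open>t\<close>, the program minimises \<open>\<beta>\<close> subject to linear constraints whose
  right-hand side depends affinely on \<open>t\<close>, so its value is piecewise linear and convex in \<open>t\<close>; at
  \<open>t = 0\<close> it vanishes by strong efficiency.  Hence the value is \<open>c * t\<close> on an initial interval,
  and dividing by \<open>t\<close> gives a constant.

  The argument is geometric.  The pairs \<open>(t, \<beta>)\<close> for which the program is solvable, with
  \<open>0 \<le> t \<le> t1\<close> and \<open>\<beta> \<le> B\<close>, are the shadow in the plane of a bounded polyhedron in
  \<open>(t, \<beta>, \<lambda>)\<close>-space, hence the convex hull of finitely many points.  This set contains the
  origin, lies in \<open>t \<ge> 0\<close>, and meets the axis \<open>t = 0\<close> only in \<open>\<beta> \<ge> 0\<close>: a solution with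
  \<open>t = 0\<close> and \<open>\<beta> < 0\<close> would increase some output without increasing any input.  Among the
  generators off the axis one has the smallest slope \<open>\<beta>/t\<close>; calling this slope \<open>c\<close>, the whole
  polygon lies above the line \<open>\<beta> = c * t\<close>, and the segment from the origin to that generator runs
  along the line (\<open>polygon_lower_boundary_at_origin\<close>).  A generator off the axis exists exactly
  because the point is not of the directional smallest scale size; that hypothesis also supplies
  \<open>t1\<close>.
\<close>

section \<open>Polygons near a boundary point\<close>

text \<open>
  Finiteness of the set of generators is what makes the infimum of the slopes \<open>\<beta>/t\<close> attained and
  finite; for a disc tangent to the axis at the origin the slopes are unbounded below.
\<close>

lemma polygon_lower_boundary_at_origin:
  fixes P :: "(real \<times> real) set"
  assumes poly: "polytope P" and origin: "(0, 0) \<in> P"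
    and right: "\<And>t b. (t, b) \<in> P \<Longrightarrow> 0 \<le> t"
    and axis: "\<And>b. (0, b) \<in> P \<Longrightarrow> 0 \<le> b"
    and off_axis: "(t1, b1) \<in> P" "0 < t1"
  obtains t0 c where "0 < t0" "\<forall>t\<in>{0<..t0}. (t, c * t) \<in> P"
    "\<forall>(t, b)\<in>P. c * t \<le> b"
proof -
  obtain V where V: "finite V" "P = convex hull V"
    using poly by (auto simp: polytope_def)
  have VP: "V \<subseteq> P"
    unfolding V(2) by (rule hull_subset)
  define S where "S = {v \<in> V. 0 < fst v}"
  have "S \<noteq> {}"
  proof
    assume "S = {}"
    then have "V \<subseteq> {z. (1, 0) \<bullet> z \<le> 0}"
      by (auto simp: S_def inner_prod_def not_less)
    then have "P \<subseteq> {z. (1, 0) \<bullet> z \<le> 0}"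
      unfolding V(2) by (rule hull_minimal) (rule convex_halfspace_le)
    with off_axis show False
      by (auto simp: inner_prod_def)
  qed
  moreover have "finite S"
    using V(1) by (simp add: S_def)
  ultimately obtain v where v: "v \<in> S" "\<And>w. w \<in> S \<Longrightarrow> snd v / fst v \<le> snd w / fst w"
    using ex_is_arg_min_if_finite[of S "\<lambda>w. snd w / fst w"]
    unfolding is_arg_min_linorder by blast
  define c where "c = snd v / fst v"
  have pos: "0 < fst v" and vV: "v \<in> V"
    using v(1) by (auto simp: S_def)
  have v_line: "(fst v, c * fst v) \<in> P"
    using VP vV pos by (auto simp: c_def)
  have "V \<subseteq> {z. (c, -1) \<bullet> z \<le> 0}"
  proof
    fix w assume w: "w \<in> V"
    show "w \<in> {z. (c, -1) \<bullet> z \<le> 0}"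
    proof (cases "fst w = 0")
      case True
      then have "0 \<le> snd w"
        using axis[of "snd w"] w VP by (metis prod.collapse subsetD)
      with True show ?thesis
        by (simp add: inner_prod_def)
    next
      case False
      moreover have "0 \<le> fst w"
        using right[of "fst w" "snd w"] w VP by auto
      ultimately have "0 < fst w"
        by simp
      then have "c \<le> snd w / fst w"
        using v(2)[of w] w by (simp add: S_def c_def)
      with \<open>0 < fst w\<close> show ?thesis
        by (simp add: inner_prod_def field_simps)
    qed
  qed
  then have above: "P \<subseteq> {z. (c, -1) \<bullet> z \<le> 0}"
    unfolding V(2) by (rule hull_minimal) (rule convex_halfspace_le)
  show ?thesis
  proof (rule that[of "fst v" c])
    show "0 < fst v"
      by (fact pos)
    show "\<forall>t\<in>{0<..fst v}. (t, c * t) \<in> P"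
    proof
      fix t assume t: "t \<in> {0<..fst v}"
      have "convex P"
        using V(2) by simp
      then have "(1 - t / fst v) *\<^sub>R (0, 0) + (t / fst v) *\<^sub>R (fst v, c * fst v) \<in> P"
        using origin v_line pos t by (intro convexD_alt) auto
      then show "(t, c * t) \<in> P"
        using pos by (simp add: mult.commute)
    qed
    show "\<forall>(t, b)\<in>P. c * t \<le> b"
      using above by (auto simp: inner_prod_def)
  qed
qed

section \<open>The solvable parameter pairs form a polygon\<close>

lemma polyhedron_linear_le:
  fixes f :: "'a::euclidean_space \<Rightarrow> real"
  assumes "linear f"
  shows "polyhedron {z. f z \<le> b}"
proof -
  have "f z = adjoint f 1 \<bullet> z" for z
    using adjoint_works[OF assms, of z 1] by (simp add: inner_commute)
  then show ?thesis
    using polyhedron_halfspace_le[of "adjoint f 1" b] by simp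
qed

lemma polyhedron_linear_le_all:
  fixes f :: "'i::finite \<Rightarrow> 'a::euclidean_space \<Rightarrow> real"
  assumes "\<And>i. linear (f i)"
  shows "polyhedron {z. \<forall>i. f i z \<le> b i}"
proof -
  have "{z. \<forall>i. f i z \<le> b i} = \<Inter> (range (\<lambda>i. {z. f i z \<le> b i}))"
    by auto
  also have "polyhedron \<dots>"
    using assms by (intro polyhedron_Inter) (auto intro: polyhedron_linear_le)
  finally show ?thesis .
qed

text \<open>
  The set is the projection of a polyhedron, and projecting preserves polytopes once that
  polyhedron is bounded.  The weights lie in a simplex, and \<open>b\<close> is bounded below because output
  \<open>r\<close>, which grows as \<open>b\<close> decreases, cannot exceed the total of the observed values.  The
  upper bounds on \<open>t\<close> and \<open>b\<close> are cut-offs: only small \<open>t\<close> matter, and large \<open>b\<close> are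
  irrelevant to a minimum.
\<close>

lemma polytope_psi_feasible_pairs:
  fixes X :: "'n::finite \<Rightarrow> real^'m" and Y :: "'n \<Rightarrow> real^'s"
  assumes Y: "\<And>j r. 0 \<le> Y j $ r" and Y0: "0 < Y0 $ r" and \<delta>: "0 < \<delta> $ r"
  shows "polytope {(t, b). 0 \<le> t \<and> t \<le> t1 \<and> b \<le> B \<and> (\<exists>l. psi_feasible X Y \<omega> \<delta> X0 Y0 t (b, l))}"
    (is "polytope ?P")
proof -
  define F :: "(real \<times> real \<times> (real^'n)) set" where
    "F = {z. - fst z \<le> 0} \<inter> {z. fst z \<le> t1} \<inter> {z. fst (snd z) \<le> B} \<inter>
      {z. \<forall>i. (\<Sum>j\<in>UNIV. snd (snd z) $ j * X j $ i) + \<omega> $ i * X0 $ i * fst z \<le> X0 $ i} \<inter>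
      {z. \<forall>r. - (\<Sum>j\<in>UNIV. snd (snd z) $ j * Y j $ r) - \<delta> $ r * Y0 $ r * fst (snd z) \<le> - Y0 $ r} \<inter>
      {z. (\<Sum>j\<in>UNIV. snd (snd z) $ j) \<le> 1} \<inter> {z. - (\<Sum>j\<in>UNIV. snd (snd z) $ j) \<le> - 1} \<inter>
      {z. \<forall>j. - (snd (snd z) $ j) \<le> 0}"
  have F_iff: "(t, b, l) \<in> F \<longleftrightarrow>
      0 \<le> t \<and> t \<le> t1 \<and> b \<le> B \<and> psi_feasible X Y \<omega> \<delta> X0 Y0 t (b, ($) l)" for t b l
    by (auto simp: F_def psi_feasible_def algebra_simps)
  have poly: "polyhedron F"
    unfolding F_def
    by (intro polyhedron_Int polyhedron_linear_le polyhedron_linear_le_all)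
      (auto intro!: linearI
        simp: algebra_simps sum.distrib sum_distrib_left sum_negf)
  define lo where "lo = (1 - (\<Sum>j\<in>UNIV. Y j $ r) / Y0 $ r) / \<delta> $ r"
  have "F \<subseteq> {0..t1} \<times> {lo..B} \<times> cbox 0 1"
  proof
    fix z assume "z \<in> F"
    moreover obtain t b l where z: "z = (t, b, l)"
      by (cases z)
    ultimately have tb: "0 \<le> t" "t \<le> t1" "b \<le> B"
      and out: "(1 - \<delta> $ r * b) * Y0 $ r \<le> (\<Sum>j\<in>UNIV. l $ j * Y j $ r)"
      and l: "(\<Sum>j\<in>UNIV. l $ j) = 1" "\<And>j. 0 \<le> l $ j"
      by (auto simp: F_iff psi_feasible_def)
    have l1: "l $ j \<le> 1" for j
      using member_le_sum[of j UNIV "($) l"] l by simp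
    have "(\<Sum>j\<in>UNIV. l $ j * Y j $ r) \<le> (\<Sum>j\<in>UNIV. Y j $ r)"
      using l1 Y by (intro sum_mono) (simp add: mult_left_le_one_le l(2))
    with out have "(1 - \<delta> $ r * b) * Y0 $ r \<le> (\<Sum>j\<in>UNIV. Y j $ r)"
      by simp
    then have "1 - \<delta> $ r * b \<le> (\<Sum>j\<in>UNIV. Y j $ r) / Y0 $ r"
      using Y0 by (simp add: pos_le_divide_eq)
    then have "lo \<le> b"
      using \<delta> by (simp add: lo_def pos_divide_le_eq mult.commute)
    with tb l1 l(2) show "z \<in> {0..t1} \<times> {lo..B} \<times> cbox 0 1"
      by (auto simp: z mem_box_cart)
  qed
  then have "bounded F"
    by (rule bounded_subset[rotated]) (intro bounded_Times bounded_closed_interval bounded_cbox)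
  with poly have "polytope F"
    by (simp add: polytope_eq_bounded_polyhedron)
  then have "polytope ((\<lambda>z. (fst z, fst (snd z))) ` F)"
    by (intro polytope_linear_image) (auto intro: linearI)
  also have "(\<lambda>z. (fst z, fst (snd z))) ` F = ?P"
  proof (intro set_eqI iffI; clarify)
    fix t b l assume "(t, b, l) \<in> F"
    then show "0 \<le> fst (t, b, l) \<and> fst (t, b, l) \<le> t1 \<and> fst (snd (t, b, l)) \<le> B \<and>
        (\<exists>l'. psi_feasible X Y \<omega> \<delta> X0 Y0 (fst (t, b, l)) (fst (snd (t, b, l)), l'))"
      by (auto simp: F_iff)
  next
    fix t b l
    assume "0 \<le> t" "t \<le> t1" "b \<le> B" "psi_feasible X Y \<omega> \<delta> X0 Y0 t (b, l)"
    then have "(t, b, \<chi> j. l j) \<in> F"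
      by (simp add: F_iff vec_lambda_inverse)
    then show "(t, b) \<in> (\<lambda>z. (fst z, fst (snd z))) ` F"
      by force
  qed
  finally show ?thesis .
qed

section \<open>The linear program and the production possibility set\<close>

text \<open>
  The program shrinks inputs and outputs by \<open>1 - \<omega> $ i * t\<close> and \<open>1 - \<delta> $ r * b\<close>, whereas the
  scaling matrices have entries with a plus sign; hence the negated parameters.
\<close>

lemma psi_feasible_iff_scaled_in_PPS:
  "(\<exists>l. psi_feasible X Y \<omega> \<delta> X0 Y0 t (b, l)) \<longleftrightarrow>
    (scaling_matrix \<omega> (- t) *v X0, scaling_matrix \<delta> (- b) *v Y0) \<in> PPS X Y"
proof -
  have scale: "(scaling_matrix w u *v V) $ i = (1 + w $ i * u) * V $ i"
    for w V :: "real^'k" and u i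
    by (simp add: scaling_matrix_def matrix_vector_mult_def if_distrib[of "\<lambda>a. a * _"] cong: if_cong)
  show ?thesis
    by (simp add: psi_feasible_def PPS_def less_eq_vec_def scale)
qed

text \<open>
  A negative \<open>b\<close> at \<open>t = 0\<close> would enlarge every output with \<open>\<delta> $ r > 0\<close> while keeping the inputs,
  so it would produce a point that dominates \<open>(X0, Y0)\<close>.
\<close>

lemma strongly_efficient_imp_psi_nonneg_at_0:
  assumes eff: "strongly_efficient X Y X0 Y0" and Y0: "\<And>r. 0 < Y0 $ r"
    and \<delta>: "\<And>r. 0 \<le> \<delta> $ r" "0 < \<delta> $ r"
    and feas: "psi_feasible X Y \<omega> \<delta> X0 Y0 0 (b, l)"
  shows "0 \<le> b"
proof (rule ccontr)
  assume "\<not> 0 \<le> b"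
  define V where "V = (\<chi> r. (1 - \<delta> $ r * b) * Y0 $ r)"
  have "(X0, V) \<in> PPS X Y"
    using feas by (auto simp: PPS_def psi_feasible_def less_eq_vec_def V_def)
  moreover have "Y0 \<le> V"
    unfolding less_eq_vec_def V_def
  proof (clarsimp)
    fix q
    have "\<delta> $ q * b \<le> 0"
      using \<delta>(1)[of q] \<open>\<not> 0 \<le> b\<close> by (simp add: mult_nonneg_nonpos)
    then show "Y0 $ q \<le> (1 - \<delta> $ q * b) * Y0 $ q"
      using Y0[of q] by simp
  qed
  moreover have "V \<noteq> Y0"
  proof
    assume "V = Y0"
    then have "(1 - \<delta> $ r * b) * Y0 $ r = Y0 $ r"
      by (metis V_def vec_lambda_beta)
    with Y0[of r] \<delta>(2) \<open>\<not> 0 \<le> b\<close> show False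
      by simp
  qed
  ultimately show False
    using eff by (auto simp: strongly_efficient_def)
qed

section \<open>Constancy of the optimal value\<close>

theorem theorem5:
  fixes X :: "'n::finite \<Rightarrow> real^'m" and Y :: "'n \<Rightarrow> real^'s"
    and X0 \<omega> :: "real^'m" and Y0 \<delta> :: "real^'s"
  assumes "\<And>j i. 0 \<le> X j $ i" and "\<And>j r. 0 \<le> Y j $ r"
    and "(X0, Y0) \<in> PPS X Y" and "strongly_efficient X Y X0 Y0"
    and "\<And>i. 0 < X0 $ i" and "\<And>r. 0 < Y0 $ r"
    and "\<And>i. 0 \<le> \<omega> $ i" and "(\<Sum>i\<in>UNIV. \<omega> $ i) = real CARD('m)"
    and "\<And>r. 0 \<le> \<delta> $ r" and "(\<Sum>r\<in>UNIV. \<delta> $ r) = real CARD('s)"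
    and "\<not> directional_smallest_scale_size X Y \<omega> \<delta> X0 Y0"
  shows "\<exists>t0 > 0. \<exists>c. \<forall>t \<in> {0<..t0}. psi_optimal_value X Y \<omega> \<delta> X0 Y0 t c"
proof -
  let ?feas = "psi_feasible X Y \<omega> \<delta> X0 Y0"
  have "0 < (\<Sum>r\<in>UNIV. \<delta> $ r)"
    using assms(10) by simp
  then obtain r where r: "0 < \<delta> $ r"
    by (metis not_less sum_nonpos)
  obtain b' t' where "t' < 0"
      "(scaling_matrix \<omega> t' *v X0, scaling_matrix \<delta> b' *v Y0) \<in> PPS X Y"
    using assms(4,11) unfolding directional_smallest_scale_size_def by blast
  then obtain t1 b1 l1 where t1: "0 < t1" and feas1: "?feas t1 (b1, l1)"
    using psi_feasible_iff_scaled_in_PPS[of X Y \<omega> \<delta> X0 Y0 "- t'" "- b'"] that[of "- t'"] by auto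
  \<comment> \<open>The bound on \<open>b\<close> must admit both the origin and \<open>(t1, b1)\<close>.\<close>
  define B where "B = max 0 b1"
  define P where "P = {(t, b). 0 \<le> t \<and> t \<le> t1 \<and> b \<le> B \<and> (\<exists>l. ?feas t (b, l))}"
  have poly: "polytope P"
    unfolding P_def using assms(2,6) r by (rule polytope_psi_feasible_pairs)
  have origin: "(0, 0) \<in> P"
    using assms(3) t1 by (auto simp: P_def B_def PPS_def psi_feasible_def less_eq_vec_def)
  have right: "0 \<le> t" if "(t, b) \<in> P" for t b
    using that by (simp add: P_def)
  have axis: "0 \<le> b" if "(0, b) \<in> P" for b
    using that strongly_efficient_imp_psi_nonneg_at_0[OF assms(4,6,9) r] by (auto simp: P_def)
  have off_axis: "(t1, b1) \<in> P"
    using t1 feas1 by (auto simp: P_def B_def)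
  obtain t0 c where t0: "0 < t0"
    and line: "\<forall>t\<in>{0<..t0}. (t, c * t) \<in> P"
    and above: "\<forall>(t, b)\<in>P. c * t \<le> b"
    using polygon_lower_boundary_at_origin[OF poly origin right axis off_axis t1] .
  have "psi_optimal_value X Y \<omega> \<delta> X0 Y0 t c" if t: "t \<in> {0<..t0}" for t
  proof -
    have on_line: "(t, c * t) \<in> P"
      using line t by blast
    then obtain l where feas: "?feas t (c * t, l)"
      by (auto simp: P_def)
    have lower: "c * t \<le> b" if "?feas t (b, l')" for b l'
    proof (cases "b \<le> B")
      case True
      then have "(t, b) \<in> P"
        using that on_line by (auto simp: P_def)
      with above show ?thesis
        by blast
    next
      case False
      \<comment> \<open>The pair was cut off, but the line stays below \<open>B\<close> on the whole interval.\<close>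
      have "c * t \<le> B"
        using on_line by (simp add: P_def)
      with False show ?thesis
        by simp
    qed
    have "is_arg_min (\<lambda>(b, l). b / t) (?feas t) (c * t, l)"
      using feas lower t by (fastforce simp: is_arg_min_linorder field_simps)
    moreover have "c = c * t / t"
      using t by simp
    ultimately show ?thesis
      unfolding psi_optimal_value_def by blast
  qed
  with t0 show ?thesis
    by blast
qed

end
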